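(* Let $k$ be a commutative ring with unit, $A$ an associative unital $k$-algebra and $A_t$ a formal deformation of $A$. Then 1) $A$ is clean if and only if $A_t$ is clean. 2) $A$ is exchange if and only if $A_t$ is exchange.
   Context: Let $\alpha$ denote the multiplication of $A$. A (formal) deformation $A_t$ of $A$ is the $k[[t]]$-module $A[[t]]$ equipped with an associative $k[[t]]$-bilinear multiplication $\alpha_t$ of the form $\alpha_t=\alpha+t\alpha_1+t^2\alpha_2+\cdots$, where each $\alpha_i:A\times A\to A$ is $k$-bilinear, extended to power series; explicitly, with $\alpha_0=\alpha$, $\alpha_t\left(\sum_n a_nt^n,\sum_p b_pt^p\right)=\sum_{r\ge 0}\left(\sum_{m+n+p=r}\alpha_m(a_n,b_p)\right)t^r$. Standing assumption: the deformation does not change the unit, i.e. the unit $1$ of $A$ is also the unit of $A_t$. A unital ring $R$ is clean if every $a\in R$ can be written $a=e+u$ with $e$ idempotent and $u$ invertible in $R$. It is exchange if for every $a\in R$ there is an idempotent $e\in R$ with $e\in aR$ and $1-e\in(1-a)R$. *)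

theory Defs
  imports "HOL-Algebra.Algebra"
begin

definition bilinear_op ::
    "('k, 'm) ring_scheme \<Rightarrow> ('k, 'a, 'n) module_scheme \<Rightarrow> ('a \<Rightarrow> 'a \<Rightarrow> 'a) \<Rightarrow> bool" where
  "bilinear_op K A \<beta> \<longleftrightarrow>
     (\<forall>x\<in>carrier A. \<forall>y\<in>carrier A. \<beta> x y \<in> carrier A) \<and>
     (\<forall>x\<in>carrier A. \<forall>x'\<in>carrier A. \<forall>y\<in>carrier A.
        \<beta> (x \<oplus>\<^bsub>A\<^esub> x') y = \<beta> x y \<oplus>\<^bsub>A\<^esub> \<beta> x' y) \<and>
     (\<forall>x\<in>carrier A. \<forall>y\<in>carrier A. \<forall>y'\<in>carrier A.
        \<beta> x (y \<oplus>\<^bsub>A\<^esub> y') = \<beta> x y \<oplus>\<^bsub>A\<^esub> \<beta> x y') \<and>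
     (\<forall>c\<in>carrier K. \<forall>x\<in>carrier A. \<forall>y\<in>carrier A.
        \<beta> (c \<odot>\<^bsub>A\<^esub> x) y = c \<odot>\<^bsub>A\<^esub> \<beta> x y \<and> \<beta> x (c \<odot>\<^bsub>A\<^esub> y) = c \<odot>\<^bsub>A\<^esub> \<beta> x y)"

text \<open>The library locale \<^locale>\<open>algebra\<close> only covers commutative algebras.\<close>

locale assoc_algebra = module K A + A: ring A
  for K (structure) and A (structure) +
  assumes mult_bilinear: "bilinear_op K A (\<lambda>x y. x \<otimes>\<^bsub>A\<^esub> y)"

text \<open>The formal power series \<open>\<Sum>n. a\<^sub>n t\<^sup>n\<close> is represented by its coefficient sequence
  \<open>\<lambda>n. a\<^sub>n\<close>.\<close>

definition power_series_ring :: "('k, 'm) ring_scheme \<Rightarrow> (nat \<Rightarrow> 'k) ring" where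
  "power_series_ring K =
     \<lparr>carrier = UNIV \<rightarrow> carrier K,
      monoid.mult = (\<lambda>p q n. \<Oplus>\<^bsub>K\<^esub>i\<in>{..n}. p i \<otimes>\<^bsub>K\<^esub> q (n - i)),
      monoid.one = (\<lambda>n. if n = 0 then \<one>\<^bsub>K\<^esub> else \<zero>\<^bsub>K\<^esub>),
      ring.zero = (\<lambda>n. \<zero>\<^bsub>K\<^esub>),
      ring.add = (\<lambda>p q n. p n \<oplus>\<^bsub>K\<^esub> q n)\<rparr>"

definition deformed_mult ::
    "('k, 'a, 'n) module_scheme \<Rightarrow> (nat \<Rightarrow> 'a \<Rightarrow> 'a \<Rightarrow> 'a) \<Rightarrow>
     (nat \<Rightarrow> 'a) \<Rightarrow> (nat \<Rightarrow> 'a) \<Rightarrow> nat \<Rightarrow> 'a" where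
  "deformed_mult A \<alpha> a b =
     (\<lambda>r. finsum A (\<lambda>(m, n, p). \<alpha> m (a n) (b p)) {(m, n, p). m + n + p = r})"

text \<open>The index set is finite, so \<^const>\<open>finsum\<close> does not take its default value.\<close>

lemma finite_deformed_index: "finite {(m, n, p). m + n + p = (r::nat)}"
  by (rule finite_subset[of _ "{..r} \<times> {..r} \<times> {..r}"]) auto

text \<open>The \<open>K[[t]]\<close>-module \<open>A[[t]]\<close> with the multiplication given by the family \<open>\<alpha>\<close>.\<close>

definition deformed_algebra ::
    "('k, 'a, 'n) module_scheme \<Rightarrow> (nat \<Rightarrow> 'a \<Rightarrow> 'a \<Rightarrow> 'a) \<Rightarrow> (nat \<Rightarrow> 'k, nat \<Rightarrow> 'a) module" where
  "deformed_algebra A \<alpha> =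
     \<lparr>carrier = UNIV \<rightarrow> carrier A,
      monoid.mult = deformed_mult A \<alpha>,
      monoid.one = (\<lambda>n. if n = 0 then \<one>\<^bsub>A\<^esub> else \<zero>\<^bsub>A\<^esub>),
      ring.zero = (\<lambda>n. \<zero>\<^bsub>A\<^esub>),
      ring.add = (\<lambda>a b n. a n \<oplus>\<^bsub>A\<^esub> b n),
      smult = (\<lambda>p a n. \<Oplus>\<^bsub>A\<^esub>i\<in>{..n}. p i \<odot>\<^bsub>A\<^esub> a (n - i))\<rparr>"

locale formal_deformation = assoc_algebra K A
  for K :: "('k, 'm) ring_scheme" (structure)
    and A :: "('k, 'a, 'n) module_scheme" (structure) +
  fixes \<alpha> :: "nat \<Rightarrow> 'a \<Rightarrow> 'a \<Rightarrow> 'a"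
    and At :: "(nat \<Rightarrow> 'k, nat \<Rightarrow> 'a) module" (structure)
  defines At_def: "At \<equiv> deformed_algebra A \<alpha>"
  assumes coeff_bilinear: "\<And>i. bilinear_op K A (\<alpha> i)"
    and coeff_0: "\<And>x y. \<lbrakk>x \<in> carrier A; y \<in> carrier A\<rbrakk> \<Longrightarrow> \<alpha> 0 x y = x \<otimes>\<^bsub>A\<^esub> y"
    and series_bilinear: "bilinear_op (power_series_ring K) At (\<lambda>a b. a \<otimes>\<^bsub>At\<^esub> b)"
    and assoc: "\<And>a b c. \<lbrakk>a \<in> carrier At; b \<in> carrier At; c \<in> carrier At\<rbrakk> \<Longrightarrow>
        (a \<otimes>\<^bsub>At\<^esub> b) \<otimes>\<^bsub>At\<^esub> c = a \<otimes>\<^bsub>At\<^esub> (b \<otimes>\<^bsub>At\<^esub> c)"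
    and unit_l: "\<And>a. a \<in> carrier At \<Longrightarrow> \<one>\<^bsub>At\<^esub> \<otimes>\<^bsub>At\<^esub> a = a"
    and unit_r: "\<And>a. a \<in> carrier At \<Longrightarrow> a \<otimes>\<^bsub>At\<^esub> \<one>\<^bsub>At\<^esub> = a"

lemma (in formal_deformation) deformed_algebra_ring: "ring (deformed_algebra A \<alpha>)"
proof (rule ringI)
  show "abelian_group (deformed_algebra A \<alpha>)"
  proof (rule abelian_groupI)
    fix x assume x: "x \<in> carrier (deformed_algebra A \<alpha>)"
    have "(\<lambda>n. \<ominus>\<^bsub>A\<^esub> x n) \<in> carrier (deformed_algebra A \<alpha>)"
      using x by (auto simp: deformed_algebra_def)
    moreover have "(\<lambda>n. \<ominus>\<^bsub>A\<^esub> x n) \<oplus>\<^bsub>deformed_algebra A \<alpha>\<^esub> x = \<zero>\<^bsub>deformed_algebra A \<alpha>\<^esub>"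
      using x by (auto simp: deformed_algebra_def Pi_iff M.l_neg)
    ultimately show "\<exists>y\<in>carrier (deformed_algebra A \<alpha>).
        y \<oplus>\<^bsub>deformed_algebra A \<alpha>\<^esub> x = \<zero>\<^bsub>deformed_algebra A \<alpha>\<^esub>" by blast
  qed (auto simp: deformed_algebra_def Pi_iff M.a_ac)
  show "monoid (deformed_algebra A \<alpha>)"
  proof (rule monoidI)
    show "\<one>\<^bsub>deformed_algebra A \<alpha>\<^esub> \<in> carrier (deformed_algebra A \<alpha>)"
      by (auto simp: deformed_algebra_def)
  qed (use series_bilinear assoc unit_l unit_r in \<open>auto simp: At_def bilinear_op_def\<close>)
qed (use series_bilinear in \<open>auto simp: At_def bilinear_op_def\<close>)

locale clean_ring = ring +
  assumes clean: "a \<in> carrier R \<Longrightarrow>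
    \<exists>e\<in>carrier R. \<exists>u\<in>Units R. e \<otimes> e = e \<and> a = e \<oplus> u"

locale exchange_ring = ring +
  assumes exchange: "a \<in> carrier R \<Longrightarrow>
    \<exists>e\<in>carrier R. e \<otimes> e = e \<and> e \<in> a <# carrier R \<and> \<one> \<ominus> e \<in> (\<one> \<ominus> a) <# carrier R"

end

theory Submission
  imports Defs
begin

text \<open>The constant coefficient is a surjective ring homomorphism from \<open>A\<^sub>t\<close> to \<open>A\<close> whose kernel
  consists of the series of positive order. Since \<open>A\<^sub>t\<close> is complete for the \<open>t\<close>-adic filtration,
  invertibility is detected on the constant coefficient (Neumann series) and idempotents lift along
  it (Newton iteration). Cleanness and exchange pass to quotients and lift along a surjection with
  these two lifting properties.\<close>

section \<open>Units and idempotents in a ring complete for a filtration\<close>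

locale complete_filtered_ring = ring +
  fixes I :: "nat \<Rightarrow> 'a set"
  assumes filtration_0: "I 0 = carrier R"
    and filtration_subgroup: "additive_subgroup (I n) R"
    and filtration_Suc: "I (Suc n) \<subseteq> I n"
    and filtration_mult: "\<lbrakk>x \<in> I m; y \<in> I n\<rbrakk> \<Longrightarrow> x \<otimes> y \<in> I (m + n)"
    and separated: "(\<And>n. x \<in> I n) \<Longrightarrow> x = \<zero>"
    and complete: "\<lbrakk>\<And>n. s n \<in> carrier R; \<And>n. s (Suc n) \<ominus> s n \<in> I n\<rbrakk> \<Longrightarrow>
      \<exists>y\<in>carrier R. \<forall>n. y \<ominus> s n \<in> I n"
begin

lemma filtration_carrier: "x \<in> I n \<Longrightarrow> x \<in> carrier R"
  by (meson additive_subgroup.a_Hcarr filtration_subgroup)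

lemma filtration_add: "\<lbrakk>x \<in> I n; y \<in> I n\<rbrakk> \<Longrightarrow> x \<oplus> y \<in> I n"
  by (meson additive_subgroup.a_closed filtration_subgroup)

lemma filtration_minus: "\<lbrakk>x \<in> I n; y \<in> I n\<rbrakk> \<Longrightarrow> x \<ominus> y \<in> I n"
  by (simp add: minus_eq filtration_add additive_subgroup.a_inv_closed[OF filtration_subgroup])

text \<open>Since \<open>I 0\<close> is the whole ring, multiplicativity with one index 0 makes
  every \<open>I n\<close> a two-sided ideal; this is the left half.\<close>

lemma filtration_mult_left: "\<lbrakk>x \<in> carrier R; y \<in> I n\<rbrakk> \<Longrightarrow> x \<otimes> y \<in> I n"
  using filtration_mult[of x 0 y n] by (simp add: filtration_0)

lemma filtration_mult_right: "\<lbrakk>x \<in> I n; y \<in> carrier R\<rbrakk> \<Longrightarrow> x \<otimes> y \<in> I n"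
  using filtration_mult[of x n y 0] by (simp add: filtration_0)

lemma filtration_antimono: "m \<le> n \<Longrightarrow> I n \<subseteq> I m"
  by (rule lift_Suc_antimono_le[of I]) (use filtration_Suc in auto)

text \<open>The limit of the Neumann series \<open>1 + j + j\<^sup>2 + \<cdots>\<close>.\<close>

lemma one_minus_right_inverse:
  assumes j: "j \<in> I 1"
  obtains y where "y \<in> carrier R" "(\<one> \<ominus> j) \<otimes> y = \<one>" "\<one> \<ominus> y \<in> I 1"
proof -
  \<comment> \<open>Horner form of the partial sums: \<open>s n\<close> is 1 + j + ... + j^(n-1).
    Starting from zero makes the n-th difference j^n, which lies in \<open>I n\<close> as
    completeness requires.\<close>
  define s where "s = rec_nat \<zero> (\<lambda>_ v. \<one> \<oplus> j \<otimes> v)"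
  have s0: "s 0 = \<zero>" and sS: "s (Suc n) = \<one> \<oplus> j \<otimes> s n" for n
    by (simp_all add: s_def)
  have jc: "j \<in> carrier R" using j by (rule filtration_carrier)
  have sc: "s n \<in> carrier R" for n
    by (induction n) (simp_all add: s0 sS jc)
  have "s (Suc n) \<ominus> s n \<in> I n" for n
  proof (induction n)
    case 0
    then show ?case using sc jc by (simp add: filtration_0)
  next
    case (Suc n)
    have "s (Suc (Suc n)) \<ominus> s (Suc n) = j \<otimes> (s (Suc n) \<ominus> s n)"
      unfolding sS[of "Suc n"] using sc[of n] jc sc[of "Suc n"] sS[of n] by algebra
    then show ?case using filtration_mult[OF j Suc] by simp
  qed
  then obtain y where y: "y \<in> carrier R" and lim: "y \<ominus> s n \<in> I n" for n
    using complete[of s] sc by blast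
  have "y \<ominus> (\<one> \<oplus> j \<otimes> y) \<in> I n" for n
  proof -
    \<comment> \<open>The defect of y in the fixed-point equation y = 1 + j y is compared with the
      recursion satisfied exactly by \<open>s\<close>, so it lies in every
      \<open>I n\<close>.\<close>
    have "y \<ominus> (\<one> \<oplus> j \<otimes> y) = (y \<ominus> s (Suc n)) \<ominus> j \<otimes> (y \<ominus> s n)"
      unfolding sS using sc[of n] jc y by algebra
    then show ?thesis
      using filtration_minus[OF _ filtration_mult_left[OF jc lim[of n]]] lim[of "Suc n"]
        filtration_Suc[of n] by auto
  qed
  then have "y \<ominus> (\<one> \<oplus> j \<otimes> y) = \<zero>" by (rule separated)
  moreover have "(\<one> \<ominus> j) \<otimes> y = (y \<ominus> (\<one> \<oplus> j \<otimes> y)) \<oplus> \<one>"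
    \<comment> \<open>Once the defect vanishes this reads 1 - y = - j y. Hence y is again 1 minus an
      element of \<open>I 1\<close>, and the lemma can be applied a second time, to 1 - y.\<close>
    and "\<one> \<ominus> y = (\<zero> \<ominus> (y \<ominus> (\<one> \<oplus> j \<otimes> y))) \<ominus> j \<otimes> y"
    using y jc by algebra+
  ultimately have inv: "(\<one> \<ominus> j) \<otimes> y = \<one>" and "\<one> \<ominus> y = \<zero> \<ominus> j \<otimes> y"
    using y jc by (simp_all add: minus_eq)
  moreover have "\<zero> \<in> I 1" by (meson additive_subgroup.zero_closed filtration_subgroup)
  ultimately have "\<one> \<ominus> y \<in> I 1"
    using filtration_minus filtration_mult_right[OF j y] by simp
  with y inv show thesis by (rule that)
qed

text \<open>The right inverse y of 1 - j has itself the form 1 - j' with j' in \<open>I 1\<close>,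
  so it has a right inverse z. An element with a left inverse 1 - j and a right inverse z has them
  equal, so y is a two-sided inverse.\<close>

lemma one_minus_Units:
  assumes j: "j \<in> I 1"
  shows "\<one> \<ominus> j \<in> Units R"
proof -
  have jc: "j \<in> carrier R" using j by (rule filtration_carrier)
  obtain y where y: "y \<in> carrier R" "(\<one> \<ominus> j) \<otimes> y = \<one>" "\<one> \<ominus> y \<in> I 1"
    using one_minus_right_inverse[OF j] .
  obtain z where z: "z \<in> carrier R" "(\<one> \<ominus> (\<one> \<ominus> y)) \<otimes> z = \<one>"
    using one_minus_right_inverse[OF y(3)] .
  have yz: "y \<otimes> z = \<one>" using z y(1) by algebra
  have "\<one> \<ominus> j = (\<one> \<ominus> j) \<otimes> (y \<otimes> z)" using yz jc by simp
  also have "\<dots> = z" using y z jc by (simp add: m_assoc[symmetric])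
  finally have "y \<otimes> (\<one> \<ominus> j) = \<one>" using yz by simp
  then show ?thesis using y jc by (auto simp: Units_def)
qed

text \<open>\<open>g\<close> is the usual polynomial
  \<open>3 f\<^sup>2 - 2 f\<^sup>3\<close> that improves approximate idempotents.\<close>

lemma idempotent_Newton_step:
  assumes f: "f \<in> carrier R" and d: "f \<otimes> f \<ominus> f \<in> I n" and n: "1 \<le> n"
  defines "g \<equiv> f \<oplus> (f \<otimes> f \<ominus> f) \<otimes> (\<one> \<ominus> f \<ominus> f)"
  shows "g \<in> carrier R" "g \<otimes> g \<ominus> g \<in> I (Suc n)" "g \<ominus> f \<in> I n"
proof -
  define d where "d = f \<otimes> f \<ominus> f"
  define c where "c = \<one> \<ominus> f \<ominus> f"
  have dc: "d \<in> carrier R" "c \<in> carrier R" "d \<otimes> c \<in> carrier R"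
    using f by (simp_all add: d_def c_def)
  have dn: "d \<in> I n" using d by (simp add: d_def)
  have g: "g = f \<oplus> d \<otimes> c" by (simp add: g_def d_def c_def)
  show "g \<in> carrier R" using g f dc by simp
  have "g \<ominus> f = d \<otimes> c" unfolding g using f dc by algebra
  then show "g \<ominus> f \<in> I n" using filtration_mult_right dn dc by simp
  \<comment> \<open>All elements involved are polynomials in f, so they commute with each other
    although the ring need not be commutative.\<close>
  have df: "d \<otimes> f = f \<otimes> d" unfolding d_def using f by algebra
  have cf: "c \<otimes> f = f \<otimes> c" unfolding c_def using f
    by (simp add: minus_eq l_distr r_distr l_minus r_minus)
  have cd: "c \<otimes> d = d \<otimes> c" unfolding c_def using f dc df
    by (simp add: minus_eq l_distr r_distr l_minus r_minus)
  \<comment> \<open>The discriminant identity (1 - 2f)^2 = 1 + 4(f^2 - f).\<close>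
  have cc: "c \<otimes> c = \<one> \<oplus> d \<oplus> d \<oplus> d \<oplus> d" unfolding c_def d_def using f
    by (simp add: minus_eq l_distr r_distr l_minus r_minus minus_add a_ac)
  have zf: "(d \<otimes> c) \<otimes> f = f \<otimes> (d \<otimes> c)"
    using f dc by (simp add: m_assoc cf) (simp add: m_assoc[symmetric] df)
  have zc: "(d \<otimes> c) \<otimes> c = d \<oplus> d \<otimes> d \<oplus> d \<otimes> d \<oplus> d \<otimes> d \<oplus> d \<otimes> d"
    using dc by (simp add: m_assoc cc r_distr)
  have "(d \<otimes> c) \<otimes> (d \<otimes> c) = d \<otimes> ((c \<otimes> d) \<otimes> c)"
    using dc by (simp add: m_assoc)
  then have zz: "(d \<otimes> c) \<otimes> (d \<otimes> c) = d \<otimes> (d \<oplus> d \<otimes> d \<oplus> d \<otimes> d \<oplus> d \<otimes> d \<oplus> d \<otimes> d)"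
    by (simp add: cd zc)
  \<comment> \<open>The defect of a perturbed f is d + z^2 - z c. With z = d c and c^2 = 1 + 4d the
    terms linear in d cancel, leaving d^2 (4d - 3).\<close>
  have expand: "(f \<oplus> z) \<otimes> (f \<oplus> z) \<ominus> (f \<oplus> z) = (f \<otimes> f \<ominus> f) \<oplus> z \<otimes> z \<ominus> z \<otimes> (\<one> \<ominus> f \<ominus> f)"
    if "z \<in> carrier R" "z \<otimes> f = f \<otimes> z" for z
    using that f by (simp add: minus_eq l_distr r_distr l_minus r_minus minus_add a_ac)
  have "g \<otimes> g \<ominus> g = d \<oplus> (d \<otimes> c) \<otimes> (d \<otimes> c) \<ominus> (d \<otimes> c) \<otimes> c"
    using expand[OF dc(3) zf] by (simp add: g d_def c_def)
  also have "\<dots> = (d \<otimes> d) \<otimes> (d \<oplus> d \<oplus> d \<oplus> d \<ominus> \<one> \<ominus> \<one> \<ominus> \<one>)"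
    unfolding zz zc using dc(1)
    by (simp add: minus_eq l_distr r_distr l_minus r_minus minus_add m_assoc)
       (simp add: a_ac r_neg r_neg1 r_neg2)
  finally have "g \<otimes> g \<ominus> g = (d \<otimes> d) \<otimes> (d \<oplus> d \<oplus> d \<oplus> d \<ominus> \<one> \<ominus> \<one> \<ominus> \<one>)" .
  \<comment> \<open>The order of the defect doubles, but one extra order per step suffices; 2n is at
    least n + 1 because n is at least 1.\<close>
  moreover have "d \<otimes> d \<in> I (n + n)" using dn by (auto intro: filtration_mult)
  then have "d \<otimes> d \<in> I (Suc n)" using filtration_antimono[of "Suc n" "n + n"] n by auto
  ultimately show "g \<otimes> g \<ominus> g \<in> I (Suc n)"
    using filtration_mult_right dc by simp
qed

text \<open>The Newton iterates started at f form a Cauchy sequence whose defects have order tending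
  to infinity, so the limit is an exact idempotent. No correction leaves \<open>I 1\<close>, so the
  limit stays congruent to f.\<close>

lemma idempotent_lift:
  assumes f: "f \<in> carrier R" and d: "f \<otimes> f \<ominus> f \<in> I 1"
  obtains g where "g \<in> carrier R" "g \<otimes> g = g" "g \<ominus> f \<in> I 1"
proof -
  define N where "N g = g \<oplus> (g \<otimes> g \<ominus> g) \<otimes> (\<one> \<ominus> g \<ominus> g)" for g
  define s where "s = rec_nat f (\<lambda>_. N)"
  have s0: "s 0 = f" and sS: "s (Suc n) = N (s n)" for n
    by (simp_all add: s_def)
  have s: "s n \<in> carrier R \<and> s n \<otimes> s n \<ominus> s n \<in> I (Suc n)" for n
  proof (induction n)
    case 0
    then show ?case using f d by (simp add: s0)
  next
    case (Suc n)
    then show ?case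
      using idempotent_Newton_step(1,2)[of "s n" "Suc n"] unfolding sS N_def by simp
  qed
  have step: "s (Suc n) \<ominus> s n \<in> I (Suc n)" for n
    using s[of n] idempotent_Newton_step(3)[of "s n" "Suc n"] unfolding sS N_def by simp
  then have "s (Suc n) \<ominus> s n \<in> I n" for n
    using filtration_Suc by blast
  then obtain y where y: "y \<in> carrier R" and lim: "y \<ominus> s n \<in> I n" for n
    using complete[of s] s by blast
  have "y \<otimes> y \<ominus> y \<in> I n" for n
  proof -
    \<comment> \<open>The defect of y is expressed through the defect of \<open>s n\<close> and
      multiples of y - \<open>s n\<close>, all of which lie in \<open>I n\<close>.\<close>
    have "y \<otimes> y \<ominus> y
        = ((y \<otimes> (y \<ominus> s n) \<oplus> (y \<ominus> s n) \<otimes> s n) \<oplus> (s n \<otimes> s n \<ominus> s n)) \<ominus> (y \<ominus> s n)"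
      using y s[THEN conjunct1, of n] by algebra
    moreover have "s n \<otimes> s n \<ominus> s n \<in> I n"
      using s filtration_Suc by blast
    ultimately show ?thesis
      using s lim y
      by (metis filtration_add filtration_minus filtration_mult_left filtration_mult_right)
  qed
  then have "y \<otimes> y \<ominus> y = \<zero>" by (rule separated)
  then have idem: "y \<otimes> y = y" using y by simp
  \<comment> \<open>The limit estimate at index 0 is void, as \<open>I 0\<close> is everything. The
    detour through \<open>s 1\<close> works because the first correction already lies in
    \<open>I 1\<close>, by the sharper bound \<open>step\<close>.\<close>
  have "y \<ominus> f = (y \<ominus> s 1) \<oplus> (s (Suc 0) \<ominus> s 0)"
    using y f s[THEN conjunct1, of 1] by (simp add: s0) algebra
  also have "\<dots> \<in> I 1"
    using filtration_add[OF lim[of 1]] step[of 0] by simp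
  finally show thesis using that y idem by blast
qed

end

section \<open>Cleanness and exchange pass to homomorphic images\<close>

lemma l_coset_memI: "x \<in> H \<Longrightarrow> a \<otimes>\<^bsub>G\<^esub> x \<in> a <#\<^bsub>G\<^esub> H"
  by (auto simp: l_coset_def)

lemma (in ring_hom_ring) clean_ring_image:
  assumes surj: "h ` carrier R = carrier S" and "clean_ring R"
  shows "clean_ring S"
proof (intro clean_ring.intro clean_ring_axioms.intro)
  interpret R: clean_ring R by fact
  show "ring S" by (rule S.ring_axioms)
  fix b assume "b \<in> carrier S"
  then obtain a where a: "a \<in> carrier R" "b = h a" using surj by blast
  obtain e u where e: "e \<in> carrier R" "e \<otimes> e = e" and u: "u \<in> Units R" and eq: "a = e \<oplus> u"
    using R.clean[OF a(1)] by blast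
  obtain v where v: "v \<in> carrier R" "v \<otimes> u = \<one>" "u \<otimes> v = \<one>" and uc: "u \<in> carrier R"
    using u by (auto simp: Units_def)
  have "h u \<in> Units S"
    using v uc by (auto simp: Units_def intro!: bexI[of _ "h v"] simp flip: hom_mult)
  moreover have "h e \<otimes>\<^bsub>S\<^esub> h e = h e" using e by (simp flip: hom_mult)
  moreover have "b = h e \<oplus>\<^bsub>S\<^esub> h u" using a eq e uc by simp
  ultimately show "\<exists>e\<in>carrier S. \<exists>u\<in>Units S. e \<otimes>\<^bsub>S\<^esub> e = e \<and> b = e \<oplus>\<^bsub>S\<^esub> u"
    using e hom_closed by blast
qed

lemma (in ring_hom_ring) exchange_ring_image:
  assumes surj: "h ` carrier R = carrier S" and "exchange_ring R"
  shows "exchange_ring S"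
proof (intro exchange_ring.intro exchange_ring_axioms.intro)
  interpret R: exchange_ring R by fact
  show "ring S" by (rule S.ring_axioms)
  fix b assume "b \<in> carrier S"
  then obtain a where a: "a \<in> carrier R" "b = h a" using surj by blast
  obtain e r s where e: "e \<in> carrier R" "e \<otimes> e = e"
    and r: "r \<in> carrier R" "e = a \<otimes> r" and s: "s \<in> carrier R" "\<one> \<ominus> e = (\<one> \<ominus> a) \<otimes> s"
    using R.exchange[OF a(1)] by (auto simp: l_coset_def)
  have minus: "h (x \<ominus> y) = h x \<ominus>\<^bsub>S\<^esub> h y" if "x \<in> carrier R" "y \<in> carrier R" for x y
    using that by (simp add: a_minus_def)
  have "h e \<otimes>\<^bsub>S\<^esub> h e = h e" using e by (simp flip: hom_mult)
  moreover have "h e = b \<otimes>\<^bsub>S\<^esub> h r" using a r by simp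
  moreover have "\<one>\<^bsub>S\<^esub> \<ominus>\<^bsub>S\<^esub> h e = (\<one>\<^bsub>S\<^esub> \<ominus>\<^bsub>S\<^esub> b) \<otimes>\<^bsub>S\<^esub> h s"
    using arg_cong[OF s(2), of h] a e s(1) by (simp add: minus)
  ultimately show "\<exists>e\<in>carrier S. e \<otimes>\<^bsub>S\<^esub> e = e \<and> e \<in> b <#\<^bsub>S\<^esub> carrier S \<and>
      \<one>\<^bsub>S\<^esub> \<ominus>\<^bsub>S\<^esub> e \<in> (\<one>\<^bsub>S\<^esub> \<ominus>\<^bsub>S\<^esub> b) <#\<^bsub>S\<^esub> carrier S"
    using e(1) r(1) s(1) hom_closed l_coset_memI by metis
qed

section \<open>Lifting along surjections that reflect units and lift idempotents\<close>

locale lifting_hom = ring_hom_ring +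
  assumes surj: "h ` carrier R = carrier S"
    and Units_reflect: "\<lbrakk>x \<in> carrier R; h x \<in> Units S\<rbrakk> \<Longrightarrow> x \<in> Units R"
    and idempotents_lift: "\<lbrakk>e \<in> carrier S; e \<otimes>\<^bsub>S\<^esub> e = e\<rbrakk> \<Longrightarrow> \<exists>f\<in>carrier R. f \<otimes> f = f \<and> h f = e"
begin

lemma hom_minus: "\<lbrakk>x \<in> carrier R; y \<in> carrier R\<rbrakk> \<Longrightarrow> h (x \<ominus> y) = h x \<ominus>\<^bsub>S\<^esub> h y"
  by (simp add: a_minus_def)

text \<open>Any idempotent lift f of e will do: a - f maps to the unit u, and units are reflected,
  so a = f + (a - f) is a clean decomposition.\<close>

lemma clean_ring_lift:
  assumes "clean_ring S"
  shows "clean_ring R"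
proof (intro clean_ring.intro clean_ring_axioms.intro)
  interpret S: clean_ring S by fact
  show "ring R" by (rule R.ring_axioms)
  fix a assume a: "a \<in> carrier R"
  obtain e u where e: "e \<in> carrier S" "e \<otimes>\<^bsub>S\<^esub> e = e" and u: "u \<in> Units S"
    and eq: "h a = e \<oplus>\<^bsub>S\<^esub> u"
    using S.clean[of "h a"] a by auto
  obtain f where f: "f \<in> carrier R" "f \<otimes> f = f" "h f = e"
    using idempotents_lift[OF e] by blast
  have "h (a \<ominus> f) = u"
    using a f eq e S.Units_closed[OF u] by (simp add: hom_minus) algebra
  then have "a \<ominus> f \<in> Units R" using Units_reflect a f u by simp
  moreover have "a = f \<oplus> (a \<ominus> f)" using a f by algebra
  ultimately show "\<exists>e\<in>carrier R. \<exists>u\<in>Units R. e \<otimes> e = e \<and> a = e \<oplus> u"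
    using f by blast
qed

text \<open>Lifting \<open>h a r + (1 - h a) s = 1\<close> gives a unit \<open>u = a r' + (1 - a) s'\<close>, so that
  \<open>x = a r' u\<^sup>-\<^sup>1\<close> satisfies \<open>x \<in> a R\<close> and \<open>1 - x \<in> (1 - a) R\<close>, and \<open>h x\<close> is idempotent. For an
  idempotent lift \<open>f\<close> of \<open>h x\<close> the element \<open>w = x f + (1 - x) (1 - f)\<close> is a unit with
  \<open>w f = x f\<close> and \<open>w (1 - f) = (1 - x) (1 - f)\<close>; the idempotent sought is \<open>w f w\<^sup>-\<^sup>1\<close>.\<close>

lemma exchange_ring_lift:
  assumes "exchange_ring S"
  shows "exchange_ring R"
proof (intro exchange_ring.intro exchange_ring_axioms.intro)
  interpret S: exchange_ring S by fact
  show "ring R" by (rule R.ring_axioms)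
  fix a assume a: "a \<in> carrier R"
  obtain e r s where e: "e \<in> carrier S" "e \<otimes>\<^bsub>S\<^esub> e = e"
    and r: "r \<in> carrier S" "e = h a \<otimes>\<^bsub>S\<^esub> r"
    and s: "s \<in> carrier S" "\<one>\<^bsub>S\<^esub> \<ominus>\<^bsub>S\<^esub> e = (\<one>\<^bsub>S\<^esub> \<ominus>\<^bsub>S\<^esub> h a) \<otimes>\<^bsub>S\<^esub> s"
    using S.exchange[of "h a"] a by (auto simp: l_coset_def)
  obtain r' s' where r': "r' \<in> carrier R" "h r' = r" and s': "s' \<in> carrier R" "h s' = s"
    using r(1) s(1) by (metis surj imageE)
  define u where "u = a \<otimes> r' \<oplus> (\<one> \<ominus> a) \<otimes> s'"
  have uc: "u \<in> carrier R" using a r' s' by (simp add: u_def)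
  \<comment> \<open>The two summands of u lift e and 1 - e, so u maps to 1 and is a unit.\<close>
  have "h u = e \<oplus>\<^bsub>S\<^esub> (\<one>\<^bsub>S\<^esub> \<ominus>\<^bsub>S\<^esub> e)"
    using a r'(1) s'(1) by (simp add: u_def hom_minus r' s' s(2) flip: r(2))
  also have "\<dots> = \<one>\<^bsub>S\<^esub>" using e(1) by algebra
  finally have hu: "h u = \<one>\<^bsub>S\<^esub>" .
  then have "u \<in> Units R" using Units_reflect uc by simp
  then obtain v where v: "v \<in> carrier R" "u \<otimes> v = \<one>" by (auto simp: Units_def)
  \<comment> \<open>The inverse of u also maps to 1, so multiplying by it does not disturb images;
    this is why x still maps to e.\<close>
  have hv: "h v = \<one>\<^bsub>S\<^esub>" using arg_cong[OF v(2), of h] v(1) uc hu by simp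
  define x where "x = a \<otimes> (r' \<otimes> v)"
  have xc: "x \<in> carrier R" using a r' v by (simp add: x_def)
  have hx: "h x = e" using a r r' v hv by (simp add: x_def)
  have "u \<otimes> v = x \<oplus> (\<one> \<ominus> a) \<otimes> (s' \<otimes> v)"
    using a r' s' v(1) by (simp add: u_def x_def R.l_distr R.m_assoc)
  then have "\<one> = x \<oplus> (\<one> \<ominus> a) \<otimes> (s' \<otimes> v)" using v by simp
  moreover have "(x \<oplus> y) \<ominus> x = y" if "y \<in> carrier R" for y
    using that xc by algebra
  ultimately have x1: "\<one> \<ominus> x = (\<one> \<ominus> a) \<otimes> (s' \<otimes> v)"
    using a s' v(1) by (metis R.m_closed R.minus_closed R.one_closed)
  obtain f where f: "f \<in> carrier R" "f \<otimes> f = f" "h f = e"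
    using idempotents_lift[OF e] by blast
  define w where "w = x \<otimes> f \<oplus> (\<one> \<ominus> x) \<otimes> (\<one> \<ominus> f)"
  have wc: "w \<in> carrier R" using xc f by (simp add: w_def)
  have ee: "(\<one>\<^bsub>S\<^esub> \<ominus>\<^bsub>S\<^esub> e) \<otimes>\<^bsub>S\<^esub> (\<one>\<^bsub>S\<^esub> \<ominus>\<^bsub>S\<^esub> e) = \<one>\<^bsub>S\<^esub> \<ominus>\<^bsub>S\<^esub> e"
    using e by (simp add: S.minus_eq S.l_distr S.r_distr S.l_minus S.r_minus S.minus_add S.r_neg S.a_ac)
  \<comment> \<open>Both x and f map to e, so w maps to e^2 + (1 - e)^2, which is e + (1 - e) by
    idempotence.\<close>
  have "h w = e \<oplus>\<^bsub>S\<^esub> (\<one>\<^bsub>S\<^esub> \<ominus>\<^bsub>S\<^esub> e)"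
    using xc hx f e ee by (simp add: w_def hom_minus)
  also have "\<dots> = \<one>\<^bsub>S\<^esub>" using e(1) by algebra
  finally have "w \<in> Units R" using Units_reflect wc by simp
  then obtain z where z: "z \<in> carrier R" "w \<otimes> z = \<one>" "z \<otimes> w = \<one>" by (auto simp: Units_def)
  have ff: "(\<one> \<ominus> f) \<otimes> f = \<zero>"
    using f by (simp add: R.minus_eq R.l_distr R.l_minus R.r_neg)
  have wf: "w \<otimes> f = x \<otimes> f"
    using xc f ff by (simp add: w_def R.l_distr R.m_assoc)
  have wf': "w \<otimes> (\<one> \<ominus> f) = (\<one> \<ominus> x) \<otimes> (\<one> \<ominus> f)"
  proof -
    have "w \<otimes> (\<one> \<ominus> f) = w \<ominus> w \<otimes> f"
      using wc f by (simp add: R.minus_eq R.r_distr R.r_minus)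
    also have "\<dots> = (x \<otimes> f \<oplus> (\<one> \<ominus> x) \<otimes> (\<one> \<ominus> f)) \<ominus> x \<otimes> f" by (simp only: wf) (simp only: w_def)
    also have "\<dots> = (\<one> \<ominus> x) \<otimes> (\<one> \<ominus> f)" using xc f by algebra
    finally show ?thesis .
  qed
  define g where "g = w \<otimes> f \<otimes> z"
  have gc: "g \<in> carrier R" using wc f z by (simp add: g_def)
  have "g \<otimes> g = w \<otimes> (f \<otimes> ((z \<otimes> w) \<otimes> (f \<otimes> z)))"
    using wc f z(1) by (simp add: g_def R.m_assoc)
  also have "\<dots> = w \<otimes> (f \<otimes> f) \<otimes> z"
    using wc f(1) z(1) by (simp add: z(3) R.m_assoc)
  also have "\<dots> = g" by (simp add: f(2) g_def)
  finally have "g \<otimes> g = g" .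
  moreover have "g = a \<otimes> (r' \<otimes> v \<otimes> f \<otimes> z)"
    using a r' v(1) f(1) z(1) by (simp add: g_def wf) (simp add: x_def R.m_assoc)
  moreover have "\<one> \<ominus> g = (\<one> \<ominus> a) \<otimes> (s' \<otimes> v \<otimes> (\<one> \<ominus> f) \<otimes> z)"
  proof -
    \<comment> \<open>Writing 1 as w z exhibits 1 - g as the conjugate of 1 - f. Its factor w (1 -
      f) equals (1 - x) (1 - f), and 1 - x begins with 1 - a.\<close>
    have "\<one> \<ominus> g = w \<otimes> (\<one> \<ominus> f) \<otimes> z"
      using wc f z(1,2) by (simp add: g_def R.minus_eq R.l_distr R.r_distr R.l_minus R.r_minus)
    then show ?thesis
      using a s' v(1) f(1) z(1) by (simp add: wf' x1 R.m_assoc)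
  qed
  ultimately show "\<exists>e\<in>carrier R. e \<otimes> e = e \<and> e \<in> a <# carrier R \<and> \<one> \<ominus> e \<in> (\<one> \<ominus> a) <# carrier R"
    using gc r'(1) s'(1) v(1) f(1) z(1)
    by (metis R.m_closed R.minus_closed R.one_closed l_coset_memI)
qed

end

text \<open>Elements have equal images exactly when they are congruent modulo \<open>I 1\<close>, so
  both lifting properties become statements about \<open>I 1\<close>: the Neumann series handles
  units and the Newton iteration handles idempotents.\<close>

lemma (in complete_filtered_ring) lifting_hom_of_kernel:
  assumes hom: "ring_hom_ring R S h" and surj: "h ` carrier R = carrier S"
    and kernel: "a_kernel R S h = I 1"
  shows "lifting_hom R S h"
proof -
  interpret h: ring_hom_ring R S h by (rule hom)
  have in_kernel: "x \<ominus> y \<in> I 1 \<longleftrightarrow> h x = h y" if "x \<in> carrier R" "y \<in> carrier R" for x y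
  proof -
    have "h (x \<ominus> y) = h x \<ominus>\<^bsub>S\<^esub> h y"
      unfolding a_minus_def using that by (simp only: h.hom_add h.hom_a_inv a_inv_closed)
    moreover have "h x \<ominus>\<^bsub>S\<^esub> h y = \<zero>\<^bsub>S\<^esub> \<longleftrightarrow> h x = h y"
      using that by (intro h.S.r_right_minus_eq h.hom_closed)
    moreover have "x \<ominus> y \<in> I 1 \<longleftrightarrow> h (x \<ominus> y) = \<zero>\<^bsub>S\<^esub>"
      unfolding kernel[symmetric] a_kernel_def' using minus_closed[OF that] by blast
    ultimately show ?thesis by metis
  qed
  have unit_if: "x \<in> Units R" if "x \<in> carrier R" "h x = \<one>\<^bsub>S\<^esub>" for x
  proof -
    \<comment> \<open>An element x over 1 is 1 - j with j = 1 - x in \<open>I 1\<close>.\<close>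
    have "\<one> \<ominus> x \<in> I 1" using that in_kernel by simp
    from one_minus_Units[OF this] show ?thesis using that(1) by (simp add: minus_eq minus_add r_neg1 r_neg2)
  qed
  show ?thesis
  proof (rule lifting_hom.intro[OF hom lifting_hom_axioms.intro[OF surj]])
    fix x assume x: "x \<in> carrier R" "h x \<in> Units S"
    then obtain y' where y': "y' \<in> carrier S" "y' \<otimes>\<^bsub>S\<^esub> h x = \<one>\<^bsub>S\<^esub>" "h x \<otimes>\<^bsub>S\<^esub> y' = \<one>\<^bsub>S\<^esub>"
      by (auto simp: Units_def)
    obtain y where y: "y \<in> carrier R" "h y = y'"
      using y'(1) by (metis surj imageE)
    \<comment> \<open>With y a lift of the inverse of the image of x, both products map to 1. From x
      y a unit comes a right inverse of x, from y x a left inverse, and the two must agree.\<close>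
    have "x \<otimes> y \<in> Units R" "y \<otimes> x \<in> Units R"
      using x(1) y y' by (auto intro!: unit_if)
    then obtain p q where pq: "p \<in> carrier R" "(x \<otimes> y) \<otimes> p = \<one>"
      "q \<in> carrier R" "q \<otimes> (y \<otimes> x) = \<one>"
      by (meson Units_l_inv_ex Units_r_inv_ex)
    then have inv: "x \<otimes> (y \<otimes> p) = \<one>" "(q \<otimes> y) \<otimes> x = \<one>"
      using x(1) y(1) by (simp_all add: m_assoc)
    moreover from inv_unique[OF inv(2,1)] have "q \<otimes> y = y \<otimes> p"
      using x(1) y(1) pq by simp
    ultimately show "x \<in> Units R"
      using x(1) y(1) pq(1) unfolding Units_def by auto
  next
    fix e assume "e \<in> carrier S" and idem: "e \<otimes>\<^bsub>S\<^esub> e = e"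
    then obtain f where f: "f \<in> carrier R" "h f = e" by (metis surj imageE)
    have "f \<otimes> f \<ominus> f \<in> I 1"
      using in_kernel[of "f \<otimes> f" f] f idem by simp
    from idempotent_lift[OF f(1) this] obtain g
      where "g \<in> carrier R" "g \<otimes> g = g" "g \<ominus> f \<in> I 1" .
    then show "\<exists>f\<in>carrier R. f \<otimes> f = f \<and> h f = e" using in_kernel[of _ f] f by blast
  qed
qed

section \<open>The deformation with its t-adic filtration\<close>

context formal_deformation
begin

lemma carrier_deformed: "carrier (deformed_algebra A \<alpha>) = UNIV \<rightarrow> carrier A"
  by (simp add: deformed_algebra_def)

lemma uminus_deformed:
  assumes "x \<in> carrier (deformed_algebra A \<alpha>)"
  shows "\<ominus>\<^bsub>deformed_algebra A \<alpha>\<^esub> x = (\<lambda>n. \<ominus>\<^bsub>A\<^esub> x n)"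
proof -
  interpret B: ring "deformed_algebra A \<alpha>" by (rule deformed_algebra_ring)
  show ?thesis
    by (rule B.minus_equality)
       (use assms in \<open>auto simp: deformed_algebra_def Pi_iff M.l_neg\<close>)
qed

lemma minus_deformed:
  assumes "y \<in> carrier (deformed_algebra A \<alpha>)"
  shows "x \<ominus>\<^bsub>deformed_algebra A \<alpha>\<^esub> y = (\<lambda>n. x n \<ominus>\<^bsub>A\<^esub> y n)"
  by (simp add: a_minus_def uminus_deformed[OF assms]) (simp add: deformed_algebra_def)

lemma coeff_closed: "\<lbrakk>x \<in> carrier A; y \<in> carrier A\<rbrakk> \<Longrightarrow> \<alpha> i x y \<in> carrier A"
  using coeff_bilinear by (simp add: bilinear_op_def)

lemma coeff_zero_left:
  assumes y: "y \<in> carrier A"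
  shows "\<alpha> i \<zero>\<^bsub>A\<^esub> y = \<zero>\<^bsub>A\<^esub>"
proof -
  have "\<alpha> i (\<zero>\<^bsub>A\<^esub> \<oplus>\<^bsub>A\<^esub> \<zero>\<^bsub>A\<^esub>) y = \<alpha> i \<zero>\<^bsub>A\<^esub> y \<oplus>\<^bsub>A\<^esub> \<alpha> i \<zero>\<^bsub>A\<^esub> y"
    using coeff_bilinear y by (simp add: bilinear_op_def del: M.l_zero M.r_zero)
  then show ?thesis using coeff_closed y by simp
qed

lemma coeff_zero_right:
  assumes x: "x \<in> carrier A"
  shows "\<alpha> i x \<zero>\<^bsub>A\<^esub> = \<zero>\<^bsub>A\<^esub>"
proof -
  have "\<alpha> i x (\<zero>\<^bsub>A\<^esub> \<oplus>\<^bsub>A\<^esub> \<zero>\<^bsub>A\<^esub>) = \<alpha> i x \<zero>\<^bsub>A\<^esub> \<oplus>\<^bsub>A\<^esub> \<alpha> i x \<zero>\<^bsub>A\<^esub>"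
    using coeff_bilinear x by (simp add: bilinear_op_def del: M.l_zero M.r_zero)
  then show ?thesis using coeff_closed x by simp
qed

text \<open>Only the index triple (0, 0, 0) contributes in degree 0, and there
  \<open>\<alpha> 0\<close> is the original product. Hence the constant coefficient is
  multiplicative whatever the higher terms are.\<close>

lemma deformed_mult_0:
  assumes "a \<in> UNIV \<rightarrow> carrier A" "b \<in> UNIV \<rightarrow> carrier A"
  shows "deformed_mult A \<alpha> a b 0 = a 0 \<otimes>\<^bsub>A\<^esub> b 0"
proof -
  have "{(m, n, p). m + n + p = (0::nat)} = {(0, 0, 0)}" by auto
  then show ?thesis
    using assms coeff_closed[of "a 0" "b 0" 0] coeff_0[of "a 0" "b 0"]
    by (auto simp: deformed_mult_def Pi_iff)
qed

text \<open>The higher \<open>\<alpha> k\<close> only raise the order: k + i + j = r < m + n forces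
  i < m or j < n, so every summand has a zero argument. This makes the t-adic filtration
  multiplicative.\<close>

lemma deformed_mult_low_order:
  assumes "a \<in> UNIV \<rightarrow> carrier A" "b \<in> UNIV \<rightarrow> carrier A"
    and "\<forall>i<m. a i = \<zero>\<^bsub>A\<^esub>" "\<forall>i<n. b i = \<zero>\<^bsub>A\<^esub>" and "r < m + n"
  shows "deformed_mult A \<alpha> a b r = \<zero>\<^bsub>A\<^esub>"
proof -
  have "\<alpha> k (a i) (b j) = \<zero>\<^bsub>A\<^esub>" if "k + i + j = r" for k i j
  proof (cases "i < m")
    case False
    then have "j < n" using that assms(5) by linarith
    then show ?thesis using assms by (simp add: Pi_iff coeff_zero_right)
  qed (use assms in \<open>simp add: Pi_iff coeff_zero_left\<close>)
  then have "deformed_mult A \<alpha> a b r = (\<Oplus>\<^bsub>A\<^esub>_\<in>{(k, i, j). k + i + j = r}. \<zero>\<^bsub>A\<^esub>)"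
    unfolding deformed_mult_def by (intro M.finsum_cong') auto
  then show ?thesis by simp
qed

lemma complete_filtered_deformed:
  "complete_filtered_ring (deformed_algebra A \<alpha>) (\<lambda>n. {a \<in> UNIV \<rightarrow> carrier A. \<forall>i<n. a i = \<zero>\<^bsub>A\<^esub>})"
  (is "complete_filtered_ring ?B ?I")
proof -
  interpret B: ring ?B by (rule deformed_algebra_ring)
  show ?thesis
  proof (intro complete_filtered_ring.intro complete_filtered_ring_axioms.intro B.ring_axioms)
    show "?I 0 = carrier ?B" by (simp add: carrier_deformed)
    show "additive_subgroup (?I n) ?B" for n
    proof (rule additive_subgroup.intro, rule B.add.subgroupI)
      show "?I n \<noteq> {}" by (auto intro!: exI[of _ "\<lambda>_. \<zero>\<^bsub>A\<^esub>"])
    next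
      fix a assume a: "a \<in> ?I n"
      then show "\<ominus>\<^bsub>?B\<^esub> a \<in> ?I n" by (auto simp: uminus_deformed carrier_deformed Pi_iff)
    qed (auto simp: deformed_algebra_def Pi_iff)
    show "?I (Suc n) \<subseteq> ?I n" for n by auto
    show "a \<otimes>\<^bsub>?B\<^esub> b \<in> ?I (m + n)" if a: "a \<in> ?I m" and b: "b \<in> ?I n" for a b m n
    proof -
      have "a \<otimes>\<^bsub>?B\<^esub> b \<in> carrier ?B"
        using a b by (intro B.m_closed) (simp_all add: carrier_deformed)
      moreover have "a \<otimes>\<^bsub>?B\<^esub> b = deformed_mult A \<alpha> a b" by (simp add: deformed_algebra_def)
      ultimately show ?thesis
        using a b deformed_mult_low_order[of a b m n] by (auto simp: carrier_deformed)
    qed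
    show "a = \<zero>\<^bsub>?B\<^esub>" if a: "\<And>n. a \<in> ?I n" for a
    proof
      fix i
      show "a i = \<zero>\<^bsub>?B\<^esub> i" using a[of "Suc i"] by (simp add: deformed_algebra_def)
    qed
    show "\<exists>y\<in>carrier ?B. \<forall>n. y \<ominus>\<^bsub>?B\<^esub> s n \<in> ?I n"
      if s: "\<And>n. s n \<in> carrier ?B" and cauchy: "\<And>n. s (Suc n) \<ominus>\<^bsub>?B\<^esub> s n \<in> ?I n" for s
    proof
      have sc: "s n i \<in> carrier A" for n i using s[of n] by (auto simp: carrier_deformed)
      have step: "s (Suc n) i = s n i" if "i < n" for n i
        using cauchy[of n] that by (simp add: minus_deformed s sc)
      \<comment> \<open>Stage n fixes only the coefficients strictly below n, so coefficient i is
        final from stage i + 1 on. The limit is therefore read off along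
        \<open>s (Suc i) i\<close>.\<close>
      have stable: "s n i = s (Suc i) i" if "i < n" for n i
        using Suc_leI[OF that] by (induction n rule: dec_induct) (simp_all add: step)
      show y: "(\<lambda>i. s (Suc i) i) \<in> carrier ?B" by (auto simp: carrier_deformed sc)
      show "\<forall>n. (\<lambda>i. s (Suc i) i) \<ominus>\<^bsub>?B\<^esub> s n \<in> ?I n"
      proof
        fix n
        have "s (Suc i) i \<ominus>\<^bsub>A\<^esub> s n i = \<zero>\<^bsub>A\<^esub>" if "i < n" for i
          using sc[of "Suc i" i] by (simp add: stable[OF that] a_minus_def M.r_neg)
        then show "(\<lambda>i. s (Suc i) i) \<ominus>\<^bsub>?B\<^esub> s n \<in> ?I n"
          using sc by (auto simp: minus_deformed[OF s])
      qed
    qed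
  qed
qed

lemma constant_coeff_hom: "ring_hom_ring (deformed_algebra A \<alpha>) A (\<lambda>a. a 0)"
  by (intro ring_hom_ringI deformed_algebra_ring A.ring_axioms)
     (auto simp: deformed_algebra_def deformed_mult_0)

lemma constant_coeff_surj: "(\<lambda>a. a 0) ` carrier (deformed_algebra A \<alpha>) = carrier A"
proof
  show "carrier A \<subseteq> (\<lambda>a. a 0) ` carrier (deformed_algebra A \<alpha>)"
  proof
    fix x assume "x \<in> carrier A"
    \<comment> \<open>Only the entry at 0 matters, so the series with every coefficient x serves as
      a preimage.\<close>
    then show "x \<in> (\<lambda>a. a 0) ` carrier (deformed_algebra A \<alpha>)"
      by (intro image_eqI[of _ _ "\<lambda>_. x"]) (simp_all add: carrier_deformed)
  qed
qed (auto simp: carrier_deformed)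

text \<open>The kernel of the constant coefficient is the set of series vanishing at all i < 1,
  which is the first step of the filtration.\<close>

lemma constant_coeff_lifting_hom: "lifting_hom (deformed_algebra A \<alpha>) A (\<lambda>a. a 0)"
  by (rule complete_filtered_ring.lifting_hom_of_kernel[OF complete_filtered_deformed
        constant_coeff_hom constant_coeff_surj])
     (auto simp: a_kernel_def' carrier_deformed)

end

theorem theorem2:
  fixes K :: "('k, 'm) ring_scheme"
    and A :: "('k, 'a, 'n) module_scheme"
    and \<alpha> :: "nat \<Rightarrow> 'a \<Rightarrow> 'a \<Rightarrow> 'a"
  assumes "formal_deformation K A \<alpha>"
  shows "(clean_ring A \<longleftrightarrow> clean_ring (deformed_algebra A \<alpha>)) \<and>
         (exchange_ring A \<longleftrightarrow> exchange_ring (deformed_algebra A \<alpha>))"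
proof -
  interpret formal_deformation K A \<alpha> "deformed_algebra A \<alpha>" by (rule assms) simp
  interpret h: lifting_hom "deformed_algebra A \<alpha>" A "\<lambda>a. a 0"
    by (rule constant_coeff_lifting_hom)
  show ?thesis
    using h.clean_ring_lift h.clean_ring_image[OF h.surj]
      h.exchange_ring_lift h.exchange_ring_image[OF h.surj] by blast
qed

end
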